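(* Let $G$ be a topological rough group with rough identity element $e$. Then: (1) If $e\in G$, then for each open neighborhood $U$ of $e$ in $G$ there exists a symmetric open neighborhood $V$ of $e$ in $G$ such that $V^2\cap G\subset U$. (2) If $\{e\}$ is open in $\overline{G}$, then $G$ is a discrete space.
   Context: An approximation space $(X,R)$ is a non-empty set $X$ with an equivalence relation $R$; for $A\subset X$ the upper approximation is $\overline{A}=\{x\in X:[x]_R\cap A\neq\emptyset\}$, where $[x]_R$ is the equivalence class of $x$. Let $X$ carry a binary operation, written $xy$. A subset $G\subset X$ is a rough group if: (1) $xy\in\overline{G}$ for all $x,y\in G$; (2) $(xy)z=x(yz)$ for all $x,y,z\in\overline{G}$; (3) there is $e\in\overline{G}$ (the rough identity element, not necessarily in $G$) with $ex=xe=x$ for all $x\in\overline{G}$; (4) for every $x\in G$ there is $y\in G$ with $xy=yx=e$ (written $y=x^{-1}$). A topological rough group is a rough group $G$ together with a topology $\tau$ on $\overline{G}$ such that, with $\tau_G$ the subspace topology on $G$, the multiplication $G\times G\to\overline{G}$, $(x,y)\mapsto xy$, is continuous (product topology of $\tau_G$ on $G\times G$, $\tau$ on $\overline{G}$) and the inverse mapping $G\to G$, $x\mapsto x^{-1}$, is continuous for $\tau_G$. A subset $V\subset G$ is symmetric if $V=V^{-1}=\{v^{-1}:v\in V\}$; $V^2=\{vw:v,w\in V\}$. *)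

theory Defs
  imports "HOL-Analysis.Analysis"
begin

locale approximation_space =
  fixes X :: "'a set" and R :: "('a \<times> 'a) set"
  assumes nonempty: "X \<noteq> {}"
    and equiv: "equiv X R"

definition upper_approx :: "'a set \<Rightarrow> ('a \<times> 'a) set \<Rightarrow> 'a set \<Rightarrow> 'a set" where
  "upper_approx X R A = {x \<in> X. R `` {x} \<inter> A \<noteq> {}}"

definition is_rough_identity ::
  "'a set \<Rightarrow> ('a \<times> 'a) set \<Rightarrow> ('a \<Rightarrow> 'a \<Rightarrow> 'a) \<Rightarrow> 'a set \<Rightarrow> 'a \<Rightarrow> bool" where
  "is_rough_identity X R mul G e \<longleftrightarrow>
     e \<in> upper_approx X R G \<and> (\<forall>x\<in>upper_approx X R G. mul e x = x \<and> mul x e = x)"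

text \<open>The operation is total on the type; only its values on \<open>X\<close> matter. The identity need not lie
  in \<open>G\<close>, and \<open>G\<close> need not be closed under the operation.\<close>

locale rough_group = approximation_space X R
  for X :: "'a set" and R :: "('a \<times> 'a) set" +
  fixes mul :: "'a \<Rightarrow> 'a \<Rightarrow> 'a" and G :: "'a set"
  assumes mult_closed: "\<And>x y. x \<in> X \<Longrightarrow> y \<in> X \<Longrightarrow> mul x y \<in> X"
    and subset: "G \<subseteq> X"
    and mult_upper: "\<And>x y. x \<in> G \<Longrightarrow> y \<in> G \<Longrightarrow> mul x y \<in> upper_approx X R G"
    and assoc: "\<And>x y z. x \<in> upper_approx X R G \<Longrightarrow> y \<in> upper_approx X R G \<Longrightarrow>
      z \<in> upper_approx X R G \<Longrightarrow> mul (mul x y) z = mul x (mul y z)"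
    and identity_inverse: "\<exists>e. is_rough_identity X R mul G e \<and>
      (\<forall>x\<in>G. \<exists>y\<in>G. mul x y = e \<and> mul y x = e)"

text \<open>Both descriptions below are justified by the uniqueness lemmas that follow.\<close>

definition rough_identity ::
  "'a set \<Rightarrow> ('a \<times> 'a) set \<Rightarrow> ('a \<Rightarrow> 'a \<Rightarrow> 'a) \<Rightarrow> 'a set \<Rightarrow> 'a" where
  "rough_identity X R mul G = (THE e. is_rough_identity X R mul G e)"

definition rough_inverse ::
  "'a set \<Rightarrow> ('a \<times> 'a) set \<Rightarrow> ('a \<Rightarrow> 'a \<Rightarrow> 'a) \<Rightarrow> 'a set \<Rightarrow> 'a \<Rightarrow> 'a" where
  "rough_inverse X R mul G x =
     (THE y. y \<in> G \<and> mul x y = rough_identity X R mul G \<and> mul y x = rough_identity X R mul G)"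

context rough_group
begin

lemma subset_upper: "G \<subseteq> upper_approx X R G"
  using subset equiv unfolding upper_approx_def equiv_def refl_on_def by blast

lemma identity_unique:
  "is_rough_identity X R mul G e \<Longrightarrow> is_rough_identity X R mul G e' \<Longrightarrow> e = e'"
  unfolding is_rough_identity_def by metis

lemma rough_identity_eq:
  "is_rough_identity X R mul G e \<Longrightarrow> rough_identity X R mul G = e"
  unfolding rough_identity_def using identity_unique by blast

lemma is_rough_identity_rough_identity:
  "is_rough_identity X R mul G (rough_identity X R mul G)"
  using identity_inverse rough_identity_eq by metis

lemma inverse_ex1:
  assumes "x \<in> G"
  shows "\<exists>!y. y \<in> G \<and> mul x y = rough_identity X R mul G \<and> mul y x = rough_identity X R mul G"
proof -
  have ex: "\<exists>y. y \<in> G \<and> mul x y = rough_identity X R mul G \<and> mul y x = rough_identity X R mul G"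
    using identity_inverse assms rough_identity_eq by metis
  have "y = z"
    if y: "y \<in> G" "mul y x = rough_identity X R mul G"
      and z: "z \<in> G" "mul x z = rough_identity X R mul G" for y z
  proof -
    have up: "x \<in> upper_approx X R G" "y \<in> upper_approx X R G" "z \<in> upper_approx X R G"
      using assms y z subset_upper by auto
    show ?thesis
      using assoc[OF up(2,1,3)] y z up is_rough_identity_rough_identity
      unfolding is_rough_identity_def by simp
  qed
  with ex show ?thesis by blast
qed

lemma rough_inverse:
  assumes "x \<in> G"
  shows "rough_inverse X R mul G x \<in> G"
    and "mul x (rough_inverse X R mul G x) = rough_identity X R mul G"
    and "mul (rough_inverse X R mul G x) x = rough_identity X R mul G"
  using theI'[OF inverse_ex1[OF assms]] unfolding rough_inverse_def by auto

end

locale topological_rough_group = rough_group X R mul G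
  for X :: "'a set" and R :: "('a \<times> 'a) set" and mul :: "'a \<Rightarrow> 'a \<Rightarrow> 'a" and G :: "'a set" +
  fixes T :: "'a topology"
  assumes topspace_eq: "topspace T = upper_approx X R G"
    and continuous_mult:
      "continuous_map (prod_topology (subtopology T G) (subtopology T G)) T (\<lambda>(x, y). mul x y)"
    and continuous_inverse:
      "continuous_map (subtopology T G) (subtopology T G) (rough_inverse X R mul G)"

definition rough_symmetric ::
  "'a set \<Rightarrow> ('a \<times> 'a) set \<Rightarrow> ('a \<Rightarrow> 'a \<Rightarrow> 'a) \<Rightarrow> 'a set \<Rightarrow> 'a set \<Rightarrow> bool" where
  "rough_symmetric X R mul G V \<longleftrightarrow> V \<subseteq> G \<and> V = rough_inverse X R mul G ` V"

definition set_square :: "('a \<Rightarrow> 'a \<Rightarrow> 'a) \<Rightarrow> 'a set \<Rightarrow> 'a set" where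
  "set_square mul V = {mul v w | v w. v \<in> V \<and> w \<in> V}"

end

theory Submission
  imports Defs
begin

text \<open>The classical arguments for topological groups survive because associativity and the
  identity laws hold on the upper approximation, which contains \<open>G\<close>, although products
  may leave \<open>G\<close>. For (1), continuity of multiplication at \<open>(e, e)\<close> gives
  an open box around it whose products land in a prescribed open set; intersecting its sides and
  then intersecting the result with its own inverse makes it symmetric
  (\<open>rough_symmetric_inter_vimage\<close>). For (2), the fibre of the translation
  \<open>y \<mapsto> xy\<close> over \<open>e\<close> is the single point \<open>x^{-1}\<close>, so
  openness of \<open>{e}\<close> passes to each inverse, hence to every point of \<open>G\<close>
  (\<open>openin_singleton_rough_inverse\<close>).\<close>

context rough_group
begin

lemma rough_identity_mult:
  assumes "x \<in> G"
  shows "mul (rough_identity X R mul G) x = x" and "mul x (rough_identity X R mul G) = x"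
  using is_rough_identity_rough_identity assms subset_upper
  unfolding is_rough_identity_def by auto

text \<open>A one-sided inverse suffices: \<open>x^{-1}(xy) = (x^{-1}x)y\<close>, where
  associativity applies because all three factors lie in \<open>G\<close>.\<close>

lemma rough_inverse_eqI:
  assumes x: "x \<in> G" and y: "y \<in> G" and xy: "mul x y = rough_identity X R mul G"
  shows "rough_inverse X R mul G x = y"
proof -
  let ?i = "rough_inverse X R mul G x"
  have "?i = mul ?i (mul x y)"
    using xy rough_identity_mult rough_inverse(1)[OF x] by simp
  also have "\<dots> = mul (mul ?i x) y"
    using x y rough_inverse(1)[OF x] subset_upper by (intro assoc[symmetric]) auto
  also have "\<dots> = y"
    using rough_inverse(3)[OF x] rough_identity_mult(1)[OF y] by simp
  finally show ?thesis .
qed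

lemma rough_inverse_rough_inverse:
  assumes "x \<in> G"
  shows "rough_inverse X R mul G (rough_inverse X R mul G x) = x"
  using rough_inverse_eqI rough_inverse[OF assms] assms by blast

lemma rough_inverse_rough_identity:
  assumes "rough_identity X R mul G \<in> G"
  shows "rough_inverse X R mul G (rough_identity X R mul G) = rough_identity X R mul G"
  using assms by (intro rough_inverse_eqI rough_identity_mult)

text \<open>The set is \<open>V \<inter> V^{-1}\<close>, and inversion is an involution of
  \<open>G\<close> that swaps the two conditions.\<close>

lemma rough_symmetric_inter_vimage:
  assumes "V \<subseteq> G"
  shows "rough_symmetric X R mul G {x \<in> V. rough_inverse X R mul G x \<in> V}"
  unfolding rough_symmetric_def
  using assms rough_inverse_rough_inverse by (force simp: image_iff)

end

context topological_rough_group
begin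

lemma topspace_subtopology_G: "topspace (subtopology T G) = G"
  using topspace_eq subset_upper by auto

lemma ex_symmetric_neighbourhood:
  assumes eG: "rough_identity X R mul G \<in> G"
    and U: "openin (subtopology T G) U" "rough_identity X R mul G \<in> U"
  shows "\<exists>V. openin (subtopology T G) V \<and> rough_identity X R mul G \<in> V \<and>
    rough_symmetric X R mul G V \<and> set_square mul V \<inter> G \<subseteq> U"
proof -
  let ?e = "rough_identity X R mul G" and ?inv = "rough_inverse X R mul G"
    and ?S = "subtopology T G"
  \<comment> \<open>Multiplication takes values in the upper approximation, so its preimage has to
    be taken of a \<open>T\<close>-open set; cutting back to \<open>G\<close> at the end accounts
    for the intersection with \<open>G\<close> in the claim.\<close>
  obtain W where W: "openin T W" "U = W \<inter> G"
    using U(1) by (auto simp: openin_subtopology)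
  have "openin (prod_topology ?S ?S) {p \<in> topspace (prod_topology ?S ?S). (\<lambda>(x, y). mul x y) p \<in> W}"
    using openin_continuous_map_preimage[OF continuous_mult W(1)] .
  moreover have "(?e, ?e) \<in> {p \<in> topspace (prod_topology ?S ?S). (\<lambda>(x, y). mul x y) p \<in> W}"
    using eG U(2) W(2) rough_identity_mult(1)[OF eG] by (simp del: topspace_subtopology add: topspace_subtopology_G)
  ultimately obtain A B where AB: "openin ?S A" "openin ?S B" "?e \<in> A" "?e \<in> B"
    and sub: "A \<times> B \<subseteq> {p \<in> topspace (prod_topology ?S ?S). (\<lambda>(x, y). mul x y) p \<in> W}"
    unfolding openin_prod_topology_alt by meson
  have mulW: "mul a b \<in> W" if "a \<in> A" "b \<in> B" for a b
    using subsetD[OF sub, of "(a, b)"] that by simp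
  define C where "C = A \<inter> B"
  define V where "V = {x \<in> C. ?inv x \<in> C}"
  have C: "openin ?S C" unfolding C_def using AB by blast
  have CG: "C \<subseteq> G" using openin_subset[OF C] topspace_subtopology_G by simp
  \<comment> \<open>In this form openness of \<open>V\<close> follows from continuity of
    inversion.\<close>
  have "V = C \<inter> {x \<in> topspace ?S. ?inv x \<in> C}"
    unfolding V_def using CG topspace_subtopology_G by auto
  then have "openin ?S V"
    using openin_Int[OF C openin_continuous_map_preimage[OF continuous_inverse C]] by metis
  moreover have "?e \<in> V"
    unfolding V_def C_def using AB rough_inverse_rough_identity[OF eG] by simp
  moreover have "rough_symmetric X R mul G V"
    unfolding V_def using rough_symmetric_inter_vimage[OF CG] .
  moreover have "set_square mul V \<inter> G \<subseteq> U"
    unfolding set_square_def V_def C_def W(2) using mulW by blast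
  ultimately show ?thesis by blast
qed

text \<open>Left translation by \<open>x\<close> is continuous from \<open>G\<close> to the upper
  approximation. The identity may lie outside \<open>G\<close>, but the fibre over it lies
  inside.\<close>

lemma openin_singleton_rough_inverse:
  assumes e: "openin T {rough_identity X R mul G}" and x: "x \<in> G"
  shows "openin (subtopology T G) {rough_inverse X R mul G x}"
proof -
  let ?e = "rough_identity X R mul G" and ?S = "subtopology T G"
  have "continuous_map ?S (prod_topology ?S ?S) (\<lambda>y. (x, y))"
    using x topspace_subtopology_G by (intro continuous_map_pairedI) auto
  from continuous_map_compose[OF this continuous_mult]
  have "continuous_map ?S T (\<lambda>y. mul x y)"
    by (simp add: o_def)
  then have "openin ?S {y \<in> topspace ?S. mul x y \<in> {?e}}"
    using openin_continuous_map_preimage e by blast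
  \<comment> \<open>The fibre contains only \<open>y\<close> with \<open>xy = e\<close>, and right
    inverses in \<open>G\<close> are unique.\<close>
  moreover have "{y \<in> topspace ?S. mul x y \<in> {?e}} = {rough_inverse X R mul G x}"
    unfolding topspace_subtopology_G
    using rough_inverse[OF x] by (auto dest: rough_inverse_eqI[OF x])
  ultimately show ?thesis by simp
qed

text \<open>Each \<open>x\<close> in \<open>G\<close> is the inverse of \<open>x^{-1}\<close>, so
  all singletons of \<open>G\<close> are open.\<close>

lemma discrete_if_openin_rough_identity:
  assumes "openin T {rough_identity X R mul G}"
  shows "subtopology T G = discrete_topology G"
proof -
  have "openin (subtopology T G) {x}" if "x \<in> G" for x
    using openin_singleton_rough_inverse[OF assms rough_inverse(1)[OF that]]
      rough_inverse_rough_inverse[OF that] by simp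
  then show ?thesis
    using discrete_topology_unique[of G "subtopology T G"] topspace_subtopology_G by metis
qed

end

theorem proposition4p14:
  fixes X :: "'a set" and R :: "('a \<times> 'a) set" and mul :: "'a \<Rightarrow> 'a \<Rightarrow> 'a"
    and G :: "'a set" and T :: "'a topology" and e :: 'a
  assumes "topological_rough_group X R mul G T"
    and "e = rough_identity X R mul G"
  shows "(e \<in> G \<longrightarrow>
           (\<forall>U. openin (subtopology T G) U \<and> e \<in> U \<longrightarrow>
             (\<exists>V. openin (subtopology T G) V \<and> e \<in> V \<and> rough_symmetric X R mul G V \<and>
               set_square mul V \<inter> G \<subseteq> U))) \<and>
         (openin T {e} \<longrightarrow> subtopology T G = discrete_topology G)"
proof -
  interpret topological_rough_group X R mul G T by fact
  show ?thesis
    unfolding assms(2)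
    using ex_symmetric_neighbourhood discrete_if_openin_rough_identity by blast
qed

end
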